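(* Let $q=4$, $e>0$, and $a,b\ge 0$ integers, and let $n=q^0+q^e+2q^a+q^b$. Then, as polynomials, $g_{n,q}=S_a^2+S_bS_e$. Assume that $a+b\not\equiv 0\pmod 2$ and that $\gcd\big(x^{2a+1}+x+\epsilon(x^{2b}+1),\ (x+1)(x^e+1)\big)=(x+1)^2$ in $\mathbb{F}_2[x]$ for both $\epsilon=0$ and $\epsilon=1$. Then $g_{n,q}$ is a permutation polynomial of $\mathbb{F}_{q^e}$.
   Context: For a prime $p$, a power $q$ of $p$ and an integer $n\ge 0$, $g_{n,q}\in\mathbb{F}_p[x]$ is the unique polynomial with $\sum_{a\in\mathbb{F}_q}(x+a)^n=g_{n,q}(x^q-x)$. A permutation polynomial of a finite field $\mathbb{F}$ is a polynomial inducing a bijection of $\mathbb{F}$. For an integer $a\ge 0$, $S_a=x+x^q+\cdots+x^{q^{a-1}}$ (with $S_0=0$). *)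

theory Defs
  imports "Berlekamp_Zassenhaus.Finite_Field" "HOL-Number_Theory.Cong"
begin

(* 'p mod_ring is the prime field F_p with p = CARD('p); its elements are the residues 0,...,p-1.
   A field with q elements is any type 'f :: {field, finite} with CARD('f) = q. *)

type_synonym F2 = "bool mod_ring"

(* This is the unique ring homomorphism F_p -> F, provided that F has characteristic CARD('p). *)
definition prime_emb :: "'p::prime_card mod_ring \<Rightarrow> 'f::field" where
  "prime_emb c = of_int (to_int_mod_ring c)"

definition ext_poly :: "'p::prime_card mod_ring poly \<Rightarrow> 'f::field poly" where
  "ext_poly f = map_poly prime_emb f"

(* g_{n,q} for q = CARD('f), as a polynomial over F_p; meaningful when q is a power of p = CARD('p).
   The defining equation is an identity in F_q[x], with g read in F_q[x] via F_p -> F_q;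
   [:a, 1:] is x + a. The polynomial depends on 'f only through its cardinality, since finite
   fields with the same number of elements are isomorphic. *)
definition g_poly :: "'f::{field,finite} itself \<Rightarrow> nat \<Rightarrow> 'p::prime_card mod_ring poly" where
  "g_poly _ n = (THE g. (\<Sum>a\<in>(UNIV :: 'f set). [:a, 1:] ^ n)
                     = pcompose (ext_poly g) (monom 1 CARD('f) - monom 1 1))"

definition S_poly :: "nat \<Rightarrow> nat \<Rightarrow> 'r::comm_ring_1 poly" where
  "S_poly q a = (\<Sum>i<a. monom 1 (q ^ i))"

definition permutation_poly :: "'k::{field,finite} poly \<Rightarrow> bool" where
  "permutation_poly f \<longleftrightarrow> bij (poly f)"

end

theory Submission
  imports Defs
begin

text \<open>
  The formula for \<open>g\<close>: after expanding \<open>(x + c)^n\<close> in powers of the constant \<open>c\<close>, only the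
  coefficient of \<open>c^3\<close> survives summation over the field with 4 elements, and
  \<open>S_a(x^4 - x)\<close> telescopes to \<open>x^(4^a) - x\<close>.

  The permutation property: write \<open>T = S_e\<close> for the trace to the subfield with 4 elements and
  \<open>f = S_a^2 + S_b T\<close>. Since \<open>a + b\<close> is odd, \<open>T(f(x)) = T(x)^2\<close>, so \<open>f(x) = f(y)\<close> forces
  \<open>T(x) = T(y) = t\<close>, and \<open>z = x - y\<close> satisfies \<open>T(z) = 0\<close> and \<open>S_a(z)^2 + t S_b(z) = 0\<close>.
  Dividing \<open>z\<close> by \<open>t\<close> reduces to \<open>t\<close> being 0 or 1. Let polynomials over the prime field act on
  the field by letting \<open>X\<close> act as squaring. The hypothesis on the gcds says that the polynomials
  inducing \<open>S_a^2 + t S_b\<close> and \<open>T\<close> are coprime, so by Bezout only \<open>z = 0\<close> is annihilated by both.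
\<close>

section \<open>Finite fields of given characteristic\<close>

lemma CHAR_eq_of_CARD:
  assumes "CARD('f::{field,finite}) = p ^ e" "prime p"
  shows "CHAR('f) = p"
proof -
  have "CHAR('f) > 0"
    by (rule finite_imp_CHAR_pos) simp
  hence "prime CHAR('f)"
    by (rule prime_CHAR_semidom)
  moreover have "CHAR('f) dvd p ^ e"
    using CHAR_dvd_CARD[where ?'a = 'f] assms(1) by simp
  ultimately show ?thesis
    using assms(2) by (metis prime_dvd_power primes_dvd_imp_eq)
qed

text \<open>Multiplication by a nonzero \<open>x\<close> permutes the nonzero elements, so comparing
  their products gives \<open>x ^ (CARD('f) - 1) = 1\<close>.\<close>

lemma field_power_CARD:
  fixes x :: "'f::{field,finite}"
  shows "x ^ CARD('f) = x"
proof (cases "x = 0")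
  case False
  have pos: "0 < CARD('f)" by (simp add: finite_UNIV_card_ge_0)
  have "(\<Prod>y\<in>UNIV-{0}. y) = (\<Prod>y\<in>UNIV-{0}. x * y)"
    by (rule prod.reindex_bij_witness[of _ "\<lambda>y. x * y" "\<lambda>y. y / x"]) (use False in auto)
  also have "\<dots> = x ^ (CARD('f) - 1) * (\<Prod>y\<in>UNIV-{0}. y)"
    by (simp add: prod.distrib)
  finally have "x ^ (CARD('f) - 1) = 1"
    by simp
  thus ?thesis
    using pos by (metis Suc_diff_1 mult.right_neutral power_Suc)
qed (simp add: power_0_left)

lemma diff_power_CHAR_2:
  fixes x y :: "'r::comm_ring_1"
  assumes "CHAR('r) = 2"
  shows "(x - y) ^ 2 ^ k = x ^ 2 ^ k - y ^ 2 ^ k"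
  using freshmans_dream'[where ?'a = 'r, of "2 ^ k" k x y] assms
  by (simp add: minus_CHAR_2)

lemma add_self_CHAR_2:
  fixes x :: "'r::ring_1"
  assumes "CHAR('r) = 2"
  shows "x + x = 0"
  using minus_CHAR_2[OF assms, of x x] by simp

lemma four_power_conv: "(4::nat) ^ k = 2 ^ (2 * k)"
  by (simp add: power_mult)

lemma sum_powers_field_4:
  assumes "CARD('f::{field,finite}) = 4" "i < 6"
  shows "(\<Sum>c\<in>(UNIV::'f set). c ^ i) = (if i = 3 then 1 else 0)"
proof -
  have char: "CHAR('f) = 2"
    by (rule CHAR_eq_of_CARD[where e = 2]) (use assms in auto)
  have fourth: "c ^ 4 = c" for c :: 'f
    using field_power_CARD[of c] assms by simp
  have two: "(2::'f) = 0"
    using add_self_CHAR_2[OF char, of 1] by simp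
  have s0: "(\<Sum>c\<in>(UNIV::'f set). c ^ 0) = 0"
    using assms two by (simp, metis mult_2_right numeral_Bit0 mult_zero_right)
  \<comment> \<open>Scaling by some \<open>g\<close> other than 0 and 1 permutes the field, so the
    sum of all elements is fixed by \<open>g\<close> and must vanish. Its square is the sum of
    squares.\<close>
  have "card {0, 1::'f} < CARD('f)" using assms by simp
  then obtain g :: 'f where g: "g \<noteq> 0" "g \<noteq> 1"
    by (metis (full_types) UNIV_eq_I insertCI less_irrefl)
  have "(\<Sum>c\<in>(UNIV::'f set). c) = (\<Sum>c\<in>UNIV. g * c)"
    by (rule sum.reindex_bij_witness[of _ "\<lambda>y. g * y" "\<lambda>y. y / g"]) (use g in auto)
  hence "(\<Sum>c\<in>(UNIV::'f set). c) = g * (\<Sum>c\<in>UNIV. c)"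
    unfolding sum_distrib_left .
  hence s1: "(\<Sum>c\<in>(UNIV::'f set). c) = 0"
    using g by simp
  have "(\<Sum>c\<in>(UNIV::'f set). c) ^ 2 = (\<Sum>c\<in>UNIV. c ^ 2)"
    by (rule freshmans_dream_sum) (simp_all add: char)
  hence s2: "(\<Sum>c\<in>(UNIV::'f set). c ^ 2) = 0"
    unfolding s1 by simp
  have cube: "c ^ 3 = (if c = 0 then 0 else 1)" for c :: 'f
    using fourth[of c] by (auto simp: power_numeral_reduce)
  have "(\<Sum>c\<in>(UNIV::'f set). c ^ 3) = (\<Sum>c\<in>UNIV-{0::'f}. 1)"
    unfolding cube by (intro sum.mono_neutral_cong_right) auto
  also have "\<dots> = of_nat (2 + 1)"
    using assms(1) by (simp add: card_Diff_singleton)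
  also have "\<dots> = 1"
    unfolding of_nat_add using two by simp
  finally have s3: "(\<Sum>c\<in>(UNIV::'f set). c ^ 3) = 1" .
  have fifth: "c ^ 5 = c ^ 2" for c :: 'f
    using fourth[of c] by (simp add: power_numeral_reduce)
  have "i \<in> {0,1,2,3,4,5}" using assms(2) by auto
  thus ?thesis
    using s0 s1 s2 s3 by (auto simp: fourth fifth)
qed

section \<open>The embedding of the prime field\<close>

lemma field_hom_prime_emb:
  assumes "CHAR('f::field) = CARD('p::prime_card)"
  shows "field_hom (prime_emb :: 'p mod_ring \<Rightarrow> 'f)"
proof
  fix x y :: "'p mod_ring"
  show "prime_emb (x + y) = (prime_emb x + prime_emb y :: 'f)"
    by (simp add: prime_emb_def to_int_mod_ring_add flip: assms)
  show "prime_emb (x * y) = (prime_emb x * prime_emb y :: 'f)"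
    by (simp add: prime_emb_def to_int_mod_ring_mult flip: assms)
qed (simp_all add: prime_emb_def)

lemma prime_emb_power:
  assumes "CHAR('f::field) = CARD('p::prime_card)"
  shows "prime_emb c ^ CARD('p) = (prime_emb (c :: 'p mod_ring) :: 'f)"
proof -
  interpret field_hom "prime_emb :: 'p mod_ring \<Rightarrow> 'f"
    by (rule field_hom_prime_emb[OF assms])
  show ?thesis
    using field_power_CARD[of c] by (metis CARD_mod_ring hom_power)
qed

text \<open>Composition with a nonconstant polynomial is injective, and so is the embedding of
  coefficients. This supplies the uniqueness behind the \<open>THE\<close> in
  \<open>g_poly\<close>.\<close>

lemma pcompose_ext_poly_inject:
  fixes g h :: "'p::prime_card mod_ring poly" and r :: "'f::field poly"
  assumes "CHAR('f) = CARD('p)" "degree r > 0"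
    and eq: "pcompose (ext_poly g) r = pcompose (ext_poly h) r"
  shows "g = h"
proof -
  interpret field_hom "prime_emb :: 'p mod_ring \<Rightarrow> 'f"
    by (rule field_hom_prime_emb[OF assms(1)])
  interpret P: map_poly_inj_comm_ring_hom "prime_emb :: 'p mod_ring \<Rightarrow> 'f" ..
  have "pcompose (ext_poly g - ext_poly h) r = 0"
    by (simp add: pcompose_diff eq)
  hence "(ext_poly g :: 'f poly) = ext_poly h"
    using pcompose_eq_0 assms(2) by fastforce
  thus ?thesis
    by (simp add: ext_poly_def)
qed

lemma ext_poly_S_combination:
  assumes "CHAR('f::field) = CARD('p::prime_card)"
  shows "ext_poly ((S_poly q a)\<^sup>2 + S_poly q b * S_poly q e :: 'p mod_ring poly)
    = ((S_poly q a)\<^sup>2 + S_poly q b * S_poly q e :: 'f poly)"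
proof -
  interpret field_hom "prime_emb :: 'p mod_ring \<Rightarrow> 'f"
    by (rule field_hom_prime_emb[OF assms])
  interpret P: map_poly_inj_comm_ring_hom "prime_emb :: 'p mod_ring \<Rightarrow> 'f" ..
  have "ext_poly (S_poly q k :: 'p mod_ring poly) = (S_poly q k :: 'f poly)" for k
    unfolding ext_poly_def S_poly_def by (simp add: P.hom_sum map_poly_monom)
  thus ?thesis
    unfolding ext_poly_def by (simp add: P.hom_add P.hom_mult P.hom_power)
qed

section \<open>The polynomial \<open>g\<close> for \<open>q = 4\<close>\<close>

lemma pcompose_S_poly_4:
  assumes "CHAR('r::comm_ring_1) = 2"
  shows "pcompose (S_poly 4 a) (monom 1 4 - monom 1 1 :: 'r poly) = monom 1 (4 ^ a) - monom 1 1"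
proof -
  have "pcompose (monom 1 k) r = r ^ k" for k and r :: "'r poly"
    by (induction k) (simp_all add: monom_0 monom_Suc pcompose_pCons)
  hence "pcompose (S_poly 4 a) (monom 1 4 - monom 1 1 :: 'r poly)
      = (\<Sum>i<a. (monom 1 4 - monom 1 1) ^ 4 ^ i)"
    by (simp add: S_poly_def pcompose_sum)
  also have "\<dots> = (\<Sum>i<a. monom 1 (4 ^ Suc i) - monom 1 (4 ^ i))"
    using assms by (intro sum.cong refl)
      (simp add: four_power_conv diff_power_CHAR_2 monom_power)
  also have "\<dots> = monom 1 (4 ^ a) - monom 1 1"
    by (subst sum_lessThan_telescope) simp
  finally show ?thesis .
qed

lemma sum_shifted_powers_4:
  assumes "CARD('f::{field,finite}) = 4"
  shows "(\<Sum>c\<in>(UNIV::'f set). [:c, 1:] ^ (1 + 4 ^ e + 2 * 4 ^ a + 4 ^ b))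
    = pcompose ((S_poly 4 a)\<^sup>2 + S_poly 4 b * S_poly 4 e) (monom 1 4 - monom 1 1)"
proof -
  have char: "CHAR('f) = 2"
    by (rule CHAR_eq_of_CARD[where e = 2]) (use assms in auto)
  define X Y Z W :: "'f poly"
    where "X = monom 1 1" and "Y = monom 1 (4 ^ e)" and "Z = monom 1 (4 ^ a)" and "W = monom 1 (4 ^ b)"
  \<comment> \<open>The Frobenius power is additive and fixes \<open>c\<close>, since
    \<open>c ^ 4 = c\<close>.\<close>
  have shift: "[:c, 1:] ^ 4 ^ k = [:c:] + monom 1 (4 ^ k)" for c :: 'f and k
  proof -
    have "c ^ 4 ^ k = c"
      using field_power_CARD[of c] assms by (induction k) (simp_all add: power_mult)
    moreover have "[:c, 1:] = [:c:] + monom 1 1"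
      by (simp add: monom_altdef)
    ultimately show ?thesis
      using freshmans_dream'[where ?'a = "'f poly", of "4 ^ k" "2 * k" "[:c:]" "monom 1 1"] char
      by (simp add: monom_power four_power_conv poly_const_pow)
  qed
  have shift1: "[:c, 1:] = [:c:] + X" for c :: 'f
    using shift[of c 0] by (simp add: X_def)
  have sq: "(u + v)\<^sup>2 = u\<^sup>2 + v\<^sup>2" for u v :: "'f poly"
    by (rule freshmans_dream) (simp_all add: char)
  \<comment> \<open>The base-4 digits of the exponent add up to 1 + 1 + 2 + 1 = 5, so the degree in
    \<open>C\<close> is 5, within the range of \<open>sum_powers_field_4\<close>.\<close>
  have expand: "(C + X) * (C + Y) * (C\<^sup>2 + Z\<^sup>2) * (C + W)
      = C ^ 5 + (X + Y + W) * C ^ 4 + (X*Y + X*W + Y*W + Z\<^sup>2) * C ^ 3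
        + (X*Y*W + (X+Y+W)*Z\<^sup>2) * C ^ 2 + (X*Y + X*W + Y*W)*Z\<^sup>2 * C ^ 1 + X*Y*W*Z\<^sup>2 * C ^ 0" for C
    by (simp add: power_numeral_reduce algebra_simps)
  have summand: "[:c, 1:] ^ (1 + 4 ^ e + 2 * 4 ^ a + 4 ^ b) =
      [:c ^ 5:] + (X + Y + W) * [:c ^ 4:] + (X*Y + X*W + Y*W + Z\<^sup>2) * [:c ^ 3:]
      + (X*Y*W + (X+Y+W)*Z\<^sup>2) * [:c ^ 2:] + (X*Y + X*W + Y*W)*Z\<^sup>2 * [:c ^ 1:] + X*Y*W*Z\<^sup>2 * [:c ^ 0:]"
    for c :: 'f
  proof -
    have "[:c, 1:] ^ (1 + 4 ^ e + 2 * 4 ^ a + 4 ^ b)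
        = [:c, 1:] * [:c, 1:] ^ 4 ^ e * ([:c, 1:] ^ 4 ^ a)\<^sup>2 * [:c, 1:] ^ 4 ^ b"
      by (simp only: power_add power_one_right mult.commute[of 2] power_mult)
    also have "\<dots> = ([:c:] + X) * ([:c:] + Y) * ([:c:]\<^sup>2 + Z\<^sup>2) * ([:c:] + W)"
      unfolding shift sq by (simp only: shift1 Y_def Z_def W_def)
    also have "\<dots> = [:c:] ^ 5 + (X + Y + W) * [:c:] ^ 4 + (X*Y + X*W + Y*W + Z\<^sup>2) * [:c:] ^ 3
      + (X*Y*W + (X+Y+W)*Z\<^sup>2) * [:c:] ^ 2 + (X*Y + X*W + Y*W)*Z\<^sup>2 * [:c:] ^ 1 + X*Y*W*Z\<^sup>2 * [:c:] ^ 0"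
      by (rule expand)
    finally show ?thesis
      by (simp only: poly_const_pow)
  qed
  have const_sum: "(\<Sum>c\<in>(UNIV::'f set). [:c ^ i:]) = (if i = 3 then 1 else 0)" if "i < 6" for i
    using sum_powers_field_4[OF assms that] by (simp add: sum_to_poly flip: pCons_one)
  have "(\<Sum>c\<in>(UNIV::'f set). [:c, 1:] ^ (1 + 4 ^ e + 2 * 4 ^ a + 4 ^ b)) = X*Y + X*W + Y*W + Z\<^sup>2"
    unfolding summand sum.distrib sum_distrib_left[symmetric]
    by (simp only: const_sum) (simp add: const_sum)
  \<comment> \<open>The differences are chosen to be the telescoped forms of \<open>S_a\<close>,
    \<open>S_b\<close> and \<open>S_e\<close>; the surplus \<open>2 * X\<^sup>2\<close> vanishes in
    characteristic 2.\<close>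
  also have "\<dots> = (Z - X)\<^sup>2 + (W - X) * (Y - X)"
  proof -
    have "(Z + X)\<^sup>2 + (W + X) * (Y + X) = X*Y + X*W + Y*W + Z\<^sup>2 + (X\<^sup>2 + X\<^sup>2)"
      unfolding sq by (simp add: power2_eq_square algebra_simps)
    moreover have "X\<^sup>2 + X\<^sup>2 = 0"
      by (rule add_self_CHAR_2) (simp add: char)
    ultimately show ?thesis
      by (simp add: minus_CHAR_2 char)
  qed
  also have "\<dots> = pcompose ((S_poly 4 a)\<^sup>2 + S_poly 4 b * S_poly 4 e) (monom 1 4 - monom 1 1)"
    by (simp only: pcompose_add pcompose_mult power2_eq_square pcompose_S_poly_4[OF char]
        X_def Y_def Z_def W_def)
  finally show ?thesis .
qed

lemma g_poly_4_eq:
  assumes "CARD('f::{field,finite}) = 4"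
  shows "(g_poly TYPE('f) (1 + 4 ^ e + 2 * 4 ^ a + 4 ^ b) :: F2 poly)
    = (S_poly 4 a)\<^sup>2 + S_poly 4 b * S_poly 4 e"
  unfolding g_poly_def assms
proof (rule the_equality)
  have char: "CHAR('f) = CARD(bool)"
    by (simp, rule CHAR_eq_of_CARD[where e = 2]) (use assms in auto)
  have deg: "degree (monom 1 4 - monom 1 1 :: 'f poly) > 0"
  proof -
    have "degree (monom 1 4 - monom 1 1 :: 'f poly) = degree (monom 1 4 :: 'f poly)"
      unfolding diff_conv_add_uminus by (rule degree_add_eq_left) (simp add: degree_monom_eq)
    thus ?thesis by (simp add: degree_monom_eq)
  qed
  show *: "(\<Sum>c\<in>(UNIV::'f set). [:c, 1:] ^ (1 + 4 ^ e + 2 * 4 ^ a + 4 ^ b))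
      = pcompose (ext_poly ((S_poly 4 a)\<^sup>2 + S_poly 4 b * S_poly 4 e :: F2 poly)) (monom 1 4 - monom 1 1)"
    by (simp only: ext_poly_S_combination[OF char] sum_shifted_powers_4[OF assms])
  show "g = (S_poly 4 a)\<^sup>2 + S_poly 4 b * S_poly 4 e"
    if "(\<Sum>c\<in>(UNIV::'f set). [:c, 1:] ^ (1 + 4 ^ e + 2 * 4 ^ a + 4 ^ b))
      = pcompose (ext_poly g) (monom 1 4 - monom 1 1)" for g :: "F2 poly"
    using pcompose_ext_poly_inject[OF char deg] that * by simp
qed

section \<open>The Frobenius action of polynomials over the prime field\<close>

text \<open>A Horner scheme for the linearized polynomial attached to \<open>P\<close>: the sum of
  c_i x^(p^i), where the c_i are the coefficients of \<open>P\<close>.\<close>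

definition frob_act :: "'p::prime_card mod_ring poly \<Rightarrow> 'f::field \<Rightarrow> 'f" where
  "frob_act P x = fold_coeffs (\<lambda>c y. prime_emb c * x + y ^ CARD('p)) P 0"

context
  assumes char: "CHAR('f::field) = CARD('p::prime_card)"
begin

interpretation emb: field_hom "prime_emb :: 'p mod_ring \<Rightarrow> 'f"
  by (rule field_hom_prime_emb[OF char])

private lemma frobenius_add: "(x + y :: 'f) ^ CARD('p) = x ^ CARD('p) + y ^ CARD('p)"
  by (rule freshmans_dream) (simp_all add: char prime_card)

lemma frob_act_0 [simp]: "frob_act (0 :: 'p mod_ring poly) (x :: 'f) = 0"
  by (simp add: frob_act_def)

lemma frob_act_pCons [simp]:
  "frob_act (pCons (c :: 'p mod_ring) P) (x :: 'f) = prime_emb c * x + frob_act P x ^ CARD('p)"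
  by (cases "c = 0 \<and> P = 0") (auto simp: frob_act_def power_0_left)

lemma frob_act_zero_right [simp]: "frob_act (P :: 'p mod_ring poly) (0 :: 'f) = 0"
  by (induction P) (simp_all add: power_0_left)

lemma frob_act_add: "frob_act (P + Q :: 'p mod_ring poly) (x :: 'f) = frob_act P x + frob_act Q x"
  by (induction P Q rule: poly_induct2) (simp_all add: frobenius_add emb.hom_add algebra_simps)

text \<open>Scalars pass through the Frobenius map because it fixes the prime field.\<close>

lemma frob_act_smult: "frob_act (smult (c :: 'p mod_ring) P) (x :: 'f) = prime_emb c * frob_act P x"
  by (induction P)
    (simp_all add: power_mult_distrib emb.hom_mult algebra_simps prime_emb_power[OF char])

text \<open>Products act by composition, which makes the field a module over the polynomial ring and
  lets Bezout identities be applied to elements.\<close>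

lemma frob_act_mult:
  "frob_act (P * Q :: 'p mod_ring poly) (x :: 'f) = frob_act P (frob_act Q x)"
  by (induction P) (simp_all add: frob_act_add frob_act_smult)

lemma frob_act_monom: "frob_act (monom 1 k :: 'p mod_ring poly) (x :: 'f) = x ^ CARD('p) ^ k"
  by (induction k) (simp_all add: monom_0 monom_Suc power_0_left mult.commute flip: power_mult)

lemma frob_act_sum:
  "frob_act (\<Sum>i\<in>A. P i :: 'p mod_ring poly) (x :: 'f) = (\<Sum>i\<in>A. frob_act (P i) x)"
  by (induction A rule: infinite_finite_induct) (simp_all add: frob_act_add)

lemma frob_act_coprime_eq_0:
  assumes "coprime P (Q :: 'p mod_ring poly)" "frob_act P (x :: 'f) = 0" "frob_act Q x = 0"
  shows "x = 0"
proof -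
  obtain U V where "U * P + V * Q = 1"
    using assms(1) bezout_coefficients_fst_snd[of P Q] by (metis coprime_iff_gcd_eq_1)
  hence "x = frob_act (U * P + V * Q) x"
    by (metis frob_act_monom monom_eq_1 power_0 power_one_right)
  also have "\<dots> = 0"
    by (simp add: frob_act_add frob_act_mult assms)
  finally show ?thesis .
qed

end

section \<open>The permutation property\<close>

text \<open>In characteristic 2 the square is X^2 - 1, so this is the geometric series in
  X^2.\<close>

lemma monom_2_geometric_sum:
  "(monom 1 1 + 1)\<^sup>2 * (\<Sum>i<k. monom 1 (2 * i)) = (monom 1 (2 * k) + 1 :: F2 poly)"
proof -
  have "(monom 1 1 + 1 :: F2 poly)\<^sup>2 = (monom 1 1)\<^sup>2 + 1\<^sup>2"
    by (rule freshmans_dream) simp_all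
  hence "(monom 1 1 + 1 :: F2 poly)\<^sup>2 = monom 1 2 - 1"
    by (simp add: monom_power minus_CHAR_2)
  moreover have "(\<Sum>i<k. monom 1 (2 * i)) = (\<Sum>i<k. monom (1::bool mod_ring) 2 ^ i)"
    by (simp add: monom_power)
  moreover have "monom 1 (2 * k) + 1 = (monom 1 2 ^ k - 1 :: F2 poly)"
    by (simp add: monom_power minus_CHAR_2)
  ultimately show ?thesis
    by (simp add: power_diff_1_eq)
qed

text \<open>Both arguments of the gcd contain the factor (X+1)^2. Cancelling it leaves
  \<open>?Q\<close> coprime to 1 + X + ... + X^(e-1), whose square is \<open>?E\<close>.\<close>

lemma coprime_associates:
  fixes \<epsilon> :: "bool mod_ring"
  assumes "gcd (monom 1 (2 * a + 1) + monom 1 1 + smult \<epsilon> (monom 1 (2 * b) + 1))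
            ((monom 1 1 + 1) * (monom 1 e + 1))
        = (monom 1 1 + 1)\<^sup>2"
  shows "coprime (monom 1 1 * (\<Sum>i<a. monom 1 (2 * i)) + smult \<epsilon> (\<Sum>i<b. monom 1 (2 * i)))
    (\<Sum>i<e. monom 1 (2 * i))"
    (is "coprime ?Q ?E")
proof -
  define l :: "F2 poly" where "l = monom 1 1 + 1"
  define G :: "F2 poly" where "G = (\<Sum>i<e. monom 1 i)"
  have "l \<noteq> 0"
  proof
    assume "l = 0"
    hence "coeff l 1 = 0" by simp
    thus False by (simp add: l_def)
  qed
  have "monom 1 (2 * a + 1) + monom 1 1 + smult \<epsilon> (monom 1 (2 * b) + 1)
      = monom 1 1 * (monom 1 (2 * a) + 1) + smult \<epsilon> (monom 1 (2 * b) + 1)"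
    by (simp add: mult_monom algebra_simps)
  also have "\<dots> = l\<^sup>2 * ?Q"
    unfolding monom_2_geometric_sum[symmetric] l_def[symmetric] by (simp add: algebra_simps)
  finally have P: "monom 1 (2 * a + 1) + monom 1 1 + smult \<epsilon> (monom 1 (2 * b) + 1) = l\<^sup>2 * ?Q" .
  have "l * G = monom 1 e + 1"
    using power_diff_1_eq[of "monom 1 1 :: F2 poly" e]
    by (simp add: l_def G_def monom_power minus_CHAR_2)
  hence E: "(monom 1 1 + 1) * (monom 1 e + 1) = l\<^sup>2 * G"
    by (simp add: power2_eq_square l_def mult.assoc)
  have "gcd (l\<^sup>2 * ?Q) (l\<^sup>2 * G) = l\<^sup>2"
    using assms unfolding P E l_def .
  \<comment> \<open>The common factor leaves the gcd only up to a unit, so the argument continues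
    with divisibility.\<close>
  hence "normalize (l\<^sup>2 * gcd ?Q G) = l\<^sup>2"
    by (simp add: gcd_mult_left)
  moreover have "l\<^sup>2 * gcd ?Q G dvd normalize (l\<^sup>2 * gcd ?Q G)"
    by (simp only: dvd_normalize_iff dvd_refl)
  ultimately have "l\<^sup>2 * gcd ?Q G dvd l\<^sup>2 * 1"
    by (simp only: mult_1_right)
  hence "is_unit (gcd ?Q G)"
    using \<open>l \<noteq> 0\<close> by (simp only: dvd_mult_cancel_left power_eq_0_iff) blast
  hence "coprime ?Q G"
    by (simp only: is_unit_gcd_iff coprime_iff_gcd_eq_1)
  hence "coprime ?Q (G\<^sup>2)"
    by simp
  also have "G\<^sup>2 = (\<Sum>i<e. (monom 1 i)\<^sup>2)"
    unfolding G_def by (rule freshmans_dream_sum) simp_all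
  also have "\<dots> = ?E"
    by (simp add: monom_power mult.commute)
  finally show ?thesis .
qed

text \<open>The value of \<open>S_poly 4 a\<close> at \<open>x\<close>. For \<open>a = e\<close>, on
  a field with \<open>4 ^ e\<close> elements, it is the trace to the subfield with 4
  elements.\<close>

definition partial_trace :: "nat \<Rightarrow> 'k::field \<Rightarrow> 'k" where
  "partial_trace a x = (\<Sum>i<a. x ^ 4 ^ i)"

section \<open>Partial traces on a field with \<open>4 ^ e\<close> elements\<close>

context
  fixes e :: nat
  assumes card: "CARD('k::{field,finite}) = 4 ^ e"
begin

private abbreviation tr :: "nat \<Rightarrow> 'k \<Rightarrow> 'k" where
  "tr \<equiv> partial_trace"

private lemmas tr_def = partial_trace_def[where ?'k = 'k]

private lemma char: "CHAR('k) = 2"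
  by (rule CHAR_eq_of_CARD[where e = "2 * e"]) (simp_all add: card four_power_conv)

private lemma pow_diff: "(x - y :: 'k) ^ 4 ^ k = x ^ 4 ^ k - y ^ 4 ^ k"
  unfolding four_power_conv by (rule diff_power_CHAR_2[OF char])

private lemma pow_add: "(x + y :: 'k) ^ 4 ^ k = x ^ 4 ^ k + y ^ 4 ^ k"
  using pow_diff[of x y k] by (simp add: minus_CHAR_2 char)

private lemma pow_sum: "(\<Sum>i\<in>A. f i :: 'k) ^ 4 ^ k = (\<Sum>i\<in>A. f i ^ 4 ^ k)"
  by (rule freshmans_dream_sum'[of _ "2 * k"]) (simp_all add: char four_power_conv)

private lemma square_sum: "(\<Sum>i\<in>A. f i :: 'k)\<^sup>2 = (\<Sum>i\<in>A. (f i)\<^sup>2)"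
  by (rule freshmans_dream_sum) (simp_all add: char)

private lemma tr_add: "tr a (x + y) = tr a x + tr a y"
  by (simp add: tr_def pow_add sum.distrib)

private lemma tr_diff: "tr a (x - y) = tr a x - tr a y"
  by (simp add: tr_def pow_diff sum_subtractf)

private lemma tr_mult: "t ^ 4 = t \<Longrightarrow> tr a (t * x) = t * tr a x"
proof -
  assume t: "t ^ 4 = t"
  have "t ^ 4 ^ i = t" for i
    by (induction i) (simp_all add: t power_mult)
  thus ?thesis
    by (simp add: tr_def power_mult_distrib sum_distrib_left)
qed

text \<open>The fourth power permutes the conjugates of \<open>x\<close> cyclically, so the trace
  lies in the subfield with 4 elements.\<close>

private lemma tr_power_4: "tr e x ^ 4 = tr e x"
proof -
  have "tr e x ^ 4 = (\<Sum>i<e. x ^ 4 ^ Suc i)"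
    using pow_sum[of "\<lambda>i. x ^ 4 ^ i" "{..<e}" 1] by (simp add: tr_def mult.commute flip: power_mult)
  \<comment> \<open>Adding \<open>x\<close> on the left completes the sum to \<open>Suc e\<close>
    terms; its last term is \<open>x\<close> again and cancels.\<close>
  also have "x ^ 4 ^ 0 + \<dots> = (\<Sum>i<Suc e. x ^ 4 ^ i)"
    by (rule sum.lessThan_Suc_shift[symmetric])
  also have "\<dots> = x ^ 4 ^ 0 + tr e x"
    using field_power_CARD[of x] by (simp add: tr_def card)
  finally show ?thesis by simp
qed

text \<open>Each of the \<open>a\<close> conjugates summed in \<open>tr a x\<close> has the same
  trace as \<open>x\<close>.\<close>

private lemma tr_commute: "tr e (tr a x) = of_nat a * tr e x"
proof -
  have "tr e (x ^ 4 ^ i) = tr e x" for i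
  proof (induction i)
    case (Suc i)
    have "tr e (x ^ 4 ^ Suc i) = tr e (x ^ 4 ^ i) ^ 4"
      using pow_sum[of "\<lambda>j. (x ^ 4 ^ i) ^ 4 ^ j" "{..<e}" 1]
      by (simp add: tr_def mult_ac flip: power_mult)
    thus ?case by (simp add: Suc tr_power_4)
  qed simp
  moreover have "tr e (\<Sum>i<a. x ^ 4 ^ i) = (\<Sum>i<a. tr e (x ^ 4 ^ i))"
    unfolding tr_def by (simp add: pow_sum) (rule sum.swap)
  ultimately show ?thesis
    by (simp add: tr_def[of a])
qed

private lemma tr_square: "tr a (x\<^sup>2) = (tr a x)\<^sup>2"
  by (simp add: tr_def square_sum mult.commute flip: power_mult)

text \<open>The factor \<open>tr e x\<close> lies in the subfield with 4 elements and can be pulled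
  out of the trace. What remains is a multiple of \<open>(tr e x)\<^sup>2\<close> by
  \<open>a\<^sup>2 + b\<close>, which has the parity of \<open>a + b\<close>.\<close>

private lemma tr_value:
  assumes "odd (a + b)"
  shows "tr e ((tr a x)\<^sup>2 + tr b x * tr e x) = (tr e x)\<^sup>2"
proof -
  have "tr e ((tr a x)\<^sup>2 + tr b x * tr e x) = (tr e (tr a x))\<^sup>2 + tr e x * tr e (tr b x)"
    by (simp add: tr_add tr_square tr_mult tr_power_4 mult.commute[of _ "tr e x"])
  also have "\<dots> = of_nat (a\<^sup>2 + b) * (tr e x)\<^sup>2"
    by (simp add: tr_commute power2_eq_square algebra_simps)
  also have "of_nat (a\<^sup>2 + b) = (1 :: 'k)"
  proof -
    have "odd (a\<^sup>2 + b)" using assms by simp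
    then obtain m where "a\<^sup>2 + b = 2 * m + 1" by (rule oddE)
    moreover have "(2 :: 'k) = 0" using add_self_CHAR_2[OF char, of 1] by simp
    ultimately show ?thesis by simp
  qed
  finally show ?thesis by simp
qed

private lemma common_zero:
  fixes \<epsilon> :: "bool mod_ring"
  assumes "gcd (monom 1 (2 * a + 1) + monom 1 1 + smult \<epsilon> (monom 1 (2 * b) + 1))
            ((monom 1 1 + 1) * (monom 1 e + 1))
        = (monom 1 1 + 1)\<^sup>2"
    and "(tr a w)\<^sup>2 + prime_emb \<epsilon> * tr b w = 0" "tr e w = 0"
  shows "w = 0"
proof -
  have char': "CHAR('k) = CARD(bool)" by (simp add: char)
  note act = frob_act_mult[OF char'] frob_act_add[OF char'] frob_act_smult[OF char']
    frob_act_sum[OF char'] frob_act_monom[OF char']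
  \<comment> \<open>X acts as squaring, so X^(2i) acts as the power map with exponent 4^i; the extra
    factor X in front of the first sum produces the square of \<open>tr a w\<close>.\<close>
  have tr_act: "frob_act (\<Sum>i<k. monom 1 (2 * i) :: F2 poly) w = tr k w" for k
    by (simp add: act tr_def four_power_conv)
  show ?thesis
  proof (rule frob_act_coprime_eq_0[OF char' coprime_associates[OF assms(1)]])
    show "frob_act (monom 1 1 * (\<Sum>i<a. monom 1 (2 * i)) + smult \<epsilon> (\<Sum>i<b. monom 1 (2 * i))) w = 0"
      unfolding act(1-3) tr_act using assms(2) by (simp add: frob_act_monom[OF char', of 1, simplified])
    show "frob_act (\<Sum>i<e. monom 1 (2 * i) :: F2 poly) w = 0"
      using assms(3) by (simp only: tr_act)
  qed
qed

lemma trace_form_inj: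
  assumes odd: "odd (a + b)"
    and gcd: "\<And>\<epsilon> :: bool mod_ring. \<epsilon> \<in> {0, 1} \<Longrightarrow>
      gcd (monom 1 (2 * a + 1) + monom 1 1 + smult \<epsilon> (monom 1 (2 * b) + 1))
            ((monom 1 1 + 1) * (monom 1 e + 1))
        = (monom 1 1 + 1)\<^sup>2"
  shows "inj (\<lambda>x. (tr a x)\<^sup>2 + tr b x * tr e x)"
proof (rule injI)
  fix x y :: 'k
  assume eq: "(tr a x)\<^sup>2 + tr b x * tr e x = (tr a y)\<^sup>2 + tr b y * tr e y"
  have sq: "(u - v)\<^sup>2 = u\<^sup>2 - v\<^sup>2" for u v :: 'k
    using diff_power_CHAR_2[OF char, of u v 1] by simp
  define t where "t = tr e x"
  have t4: "t ^ 4 = t" by (simp add: t_def tr_power_4)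
  \<comment> \<open>By \<open>tr_value\<close>, the common value of the form determines the squared
    trace, and squaring is injective.\<close>
  have "(tr e x)\<^sup>2 = (tr e y)\<^sup>2"
    using tr_value[OF odd] eq by metis
  hence "(tr e x - tr e y)\<^sup>2 = 0"
    by (simp add: sq)
  hence ty: "tr e y = t"
    by (simp add: t_def)
  define z where "z = x - y"
  have tz: "tr e z = 0"
    by (simp add: z_def tr_diff ty t_def[symmetric])
  have z: "(tr a z)\<^sup>2 + t * tr b z = 0"
    using eq unfolding z_def tr_diff sq ty t_def[symmetric] by (simp add: algebra_simps)
  have "z = 0"
  proof (cases "t = 0")
    case True
    show ?thesis
      by (rule common_zero[OF gcd[of 0]]) (use z tz True in \<open>simp_all add: prime_emb_def\<close>)
  next
    case False
    \<comment> \<open>Since \<open>t\<close> lies in the subfield with 4 elements, the partial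
      traces are linear in it. Both terms of the equation for \<open>z\<close> then scale by
      \<open>t\<^sup>2\<close>, which leaves the case \<epsilon> = 1.\<close>
    define w where "w = z / t"
    have zw: "z = t * w" using False by (simp add: w_def)
    have "t\<^sup>2 * ((tr a w)\<^sup>2 + tr b w) = 0"
      using z unfolding zw tr_mult[OF t4] by (simp add: power2_eq_square algebra_simps)
    hence "(tr a w)\<^sup>2 + tr b w = 0"
      using False by simp
    moreover have "tr e w = 0"
      using tz False unfolding zw tr_mult[OF t4] by simp
    ultimately have "w = 0"
      using common_zero[OF gcd[of 1], of w] by (simp add: prime_emb_def)
    thus ?thesis by (simp add: zw)
  qed
  thus "x = y" by (simp add: z_def)
qed

end

theorem theorem6p12:
  fixes q e a b n :: nat
  assumes "q = 4"
    and "CARD('f::{field,finite}) = q"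
    and "e > 0"
    and "n = q ^ 0 + q ^ e + 2 * q ^ a + q ^ b"
  shows "(g_poly TYPE('f) n :: F2 poly) = (S_poly q a)\<^sup>2 + S_poly q b * S_poly q e \<and>
    (CARD('k::{field,finite}) = q ^ e \<and>
     \<not> [a + b = 0] (mod 2) \<and>
     (\<forall>\<epsilon>\<in>{0, 1 :: F2}.
        gcd (monom 1 (2 * a + 1) + monom 1 1 + smult \<epsilon> (monom 1 (2 * b) + 1))
            ((monom 1 1 + 1) * (monom 1 e + 1))
        = (monom 1 1 + 1)\<^sup>2)
     \<longrightarrow> permutation_poly (ext_poly (g_poly TYPE('f) n :: F2 poly) :: 'k poly))"
proof (intro conjI impI)
  show g: "(g_poly TYPE('f) n :: F2 poly) = (S_poly q a)\<^sup>2 + S_poly q b * S_poly q e"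
    using g_poly_4_eq[where ?'f = 'f, of e a b] assms by simp
  assume *: "CARD('k) = q ^ e \<and> \<not> [a + b = 0] (mod 2) \<and>
     (\<forall>\<epsilon>\<in>{0, 1 :: F2}.
        gcd (monom 1 (2 * a + 1) + monom 1 1 + smult \<epsilon> (monom 1 (2 * b) + 1))
            ((monom 1 1 + 1) * (monom 1 e + 1))
        = (monom 1 1 + 1)\<^sup>2)"
  have card: "CARD('k) = 4 ^ e" using * assms(1) by simp
  have char: "CHAR('k) = CARD(bool)"
    using CHAR_eq_of_CARD[where ?'f = 'k and p = 2 and e = "2 * e"] card by (simp add: four_power_conv)
  \<comment> \<open>The coefficients of \<open>g_poly\<close> are now read in \<open>'k\<close>;
    \<open>'f\<close> only enters through the construction of the polynomial.\<close>
  have "poly (ext_poly (g_poly TYPE('f) n :: F2 poly) :: 'k poly)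
    = (\<lambda>x. (partial_trace a x)\<^sup>2 + partial_trace b x * partial_trace e x)"
    unfolding g ext_poly_S_combination[OF char] using assms(1)
    by (simp add: fun_eq_iff S_poly_def partial_trace_def poly_sum poly_monom)
  moreover have "odd (a + b)"
    using * by (simp add: cong_0_iff)
  hence "inj (\<lambda>x::'k. (partial_trace a x)\<^sup>2 + partial_trace b x * partial_trace e x)"
    by (rule trace_form_inj[OF card]) (use * in blast)
  ultimately show "permutation_poly (ext_poly (g_poly TYPE('f) n :: F2 poly) :: 'k poly)"
    unfolding permutation_poly_def by (simp add: bij_def finite_UNIV_inj_surj)
qed

end
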